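(* Let $r\ge2$ and $t\ge2$ be integers and let $H=(V_1\dot\cup\cdots\dot\cup V_r,E)$ be an $r$-uniform $r$-partite hypergraph with all parts of size $n$ and \[ \delta'_{r-1}(H)\ge\left\lceil\frac{n}{(r-1)t+1}\right\rceil+1. \] Then $H$ has a $t$-shallow hitting edge set.
   Context: A hypergraph $H=(V,E)$ has a finite vertex set and a finite multiset of edges (subsets of $V$). It is $r$-uniform if each edge has $r$ vertices and $r$-partite with parts $V_1,\dots,V_r$ if these partition $V$ and every edge meets each $V_i$ in at most one vertex. A set $\hat e\subseteq V$ is legal if $|\hat e\cap V_i|\le1$ for all $i$. For $\hat e$ with $|\hat e|=r-1$, $N_{r-1}(\hat e)$ is the set of vertices $v$ with $\hat e\cup\{v\}$ an edge of $H$; $\delta'_{r-1}(H)$ is the minimum of $|N_{r-1}(\hat e)|$ over all legal $(r-1)$-sets $\hat e$. For $M\subseteq E$, $\deg_M(v)$ is the number of edges of $M$ containing $v$; $M$ is hitting if $\deg_M(v)\ge1$ for all $v$, and $t$-shallow if $\deg_M(v)\le t$ for all $v$. *)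

theory Defs
  imports Complex_Main "HOL-Library.Multiset" "HOL-Library.Disjoint_Sets"
begin

record 'a hypergraph =
  verts :: "'a set"
  edges :: "'a set multiset"

definition hypergraph :: "'a hypergraph \<Rightarrow> bool" where
  "hypergraph H \<longleftrightarrow> finite (verts H) \<and> (\<forall>e \<in># edges H. e \<subseteq> verts H)"

definition uniform :: "nat \<Rightarrow> 'a hypergraph \<Rightarrow> bool" where
  "uniform r H \<longleftrightarrow> (\<forall>e \<in># edges H. card e = r)"

text \<open>The parts are given as a family \<open>P\<close>, of which only \<open>P 1, \<dots>, P r\<close> matter.\<close>

definition partite :: "nat \<Rightarrow> (nat \<Rightarrow> 'a set) \<Rightarrow> 'a hypergraph \<Rightarrow> bool" where
  "partite r P H \<longleftrightarrow>
     (\<Union>i\<in>{1..r}. P i) = verts H \<and> disjoint_family_on P {1..r} \<and>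
     (\<forall>e \<in># edges H. \<forall>i\<in>{1..r}. card (e \<inter> P i) \<le> 1)"

definition legal :: "nat \<Rightarrow> (nat \<Rightarrow> 'a set) \<Rightarrow> 'a hypergraph \<Rightarrow> 'a set \<Rightarrow> bool" where
  "legal r P H S \<longleftrightarrow> S \<subseteq> verts H \<and> (\<forall>i\<in>{1..r}. card (S \<inter> P i) \<le> 1)"

definition nbhd :: "'a hypergraph \<Rightarrow> 'a set \<Rightarrow> 'a set" where
  "nbhd H S = {v \<in> verts H. S \<union> {v} \<in># edges H}"

text \<open>
  The minimum codegree \<open>\<delta>'\<close> over the legal sets of size \<open>r - 1\<close>. For \<open>r \<ge> 1\<close> and nonempty
  parts there is such a set; otherwise the value is the unspecified \<^term>\<open>Min {}\<close>.
\<close>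

definition min_codegree :: "nat \<Rightarrow> (nat \<Rightarrow> 'a set) \<Rightarrow> 'a hypergraph \<Rightarrow> nat" where
  "min_codegree r P H = Min {card (nbhd H S) | S. legal r P H S \<and> card S = r - 1}"

text \<open>
  As the edges form a multiset, a collection of edges is a submultiset \<open>M \<subseteq># edges H\<close>, and
  degrees count parallel edges with multiplicity.
\<close>

definition deg :: "'a set multiset \<Rightarrow> 'a \<Rightarrow> nat" where
  "deg M v = size {#e \<in># M. v \<in> e#}"

definition hitting :: "'a hypergraph \<Rightarrow> 'a set multiset \<Rightarrow> bool" where
  "hitting H M \<longleftrightarrow> (\<forall>v \<in> verts H. 1 \<le> deg M v)"

definition shallow :: "nat \<Rightarrow> 'a hypergraph \<Rightarrow> 'a set multiset \<Rightarrow> bool" where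
  "shallow t H M \<longleftrightarrow> (\<forall>v \<in> verts H. deg M v \<le> t)"

end

(* Write U for the set of vertices not covered by M, deg for degrees in M, and D = (r-1)t+1.
   Among all t-shallow edge sets take M minimising 2|U| + (2r-3)|M|. Dropping an edge shows that every
   edge of M has at most one vertex of degree at least 2, so M consists of disjoint stars. As each edge
   meets each part once, the excess (the sum of deg - 1 over the covered vertices) in part k
   is |M| - n + |U_k|, where U_k is the part of U in part k.

   If every part contained an uncovered vertex, a transversal (r-1)-set of such vertices would have only
   saturated neighbours, and counting the stars gives a contradiction. Otherwise |M| >= n, hence
   each part with an uncovered vertex also has a vertex h with deg h > 1. Let f be an edge at h, and
   replace the vertices of f in some parts, including that of h, by uncovered ones. Exchanging f for a new
   edge shows that all neighbours of the resulting (r-1)-sets, except possibly one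
   (this is what the summand 1 in the codegree pays for), are core vertices: centres of stars, or vertices of
   single-edge stars. With b = (t-1)(d-1) - (|M| - n), where d is the codegree, counting gives |U| <= (r-1)b.
   Finally M is extended greedily: for each j one adds b - |U_j| edges (none if this is negative)
   whose vertex in part j is a core vertex, each covering a new vertex in every other part that
   still has an uncovered one. For each i, the sum of b - |U_j| over the j other than i is at least
   |U_i|, so everything is covered. *)

theory Submission
  imports Defs
begin

section \<open>Degrees in finite sets of edges\<close>

definition dg :: "'a set set \<Rightarrow> 'a \<Rightarrow> nat" where
  "dg M v = card {e \<in> M. v \<in> e}"

lemma dg_mono: "finite N \<Longrightarrow> M \<subseteq> N \<Longrightarrow> dg M v \<le> dg N v"
  unfolding dg_def by (rule card_mono) auto

lemma dg_insert:
  assumes "finite A" "y \<notin> A"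
  shows "dg (insert y A) v = dg A v + (if v \<in> y then 1 else 0)"
proof -
  have "{e \<in> insert y A. v \<in> e} = (if v \<in> y then insert y {e \<in> A. v \<in> e} else {e \<in> A. v \<in> e})"
    by auto
  then show ?thesis using assms by (simp add: dg_def)
qed

lemma dg_insert_le: "finite M \<Longrightarrow> dg (insert e M) v \<le> dg M v + (if v \<in> e then 1 else 0)"
  by (cases "e \<in> M") (simp_all add: insert_absorb dg_insert)

lemma dg_eq_0_iff: "finite M \<Longrightarrow> dg M v = 0 \<longleftrightarrow> (\<forall>e\<in>M. v \<notin> e)"
  by (auto simp: dg_def)

lemma dg_nonzeroE:
  assumes "finite M" "dg M v \<noteq> 0"
  obtains e where "e \<in> M" "v \<in> e"
  using assms by (auto simp: dg_eq_0_iff)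

lemma dg_pos: "finite M \<Longrightarrow> e \<in> M \<Longrightarrow> v \<in> e \<Longrightarrow> 0 < dg M v"
  using dg_eq_0_iff[of M v] by auto

lemma dg_Un_le: "finite M \<Longrightarrow> finite N \<Longrightarrow> dg (M \<union> N) v \<le> dg M v + dg N v"
proof -
  assume "finite M" "finite N"
  have "{e \<in> M \<union> N. v \<in> e} = {e \<in> M. v \<in> e} \<union> {e \<in> N. v \<in> e}" by auto
  then show ?thesis by (simp add: dg_def card_Un_le)
qed

lemma dg_remove:
  assumes "finite M" "e \<in> M" "v \<in> e"
  shows "dg (M - {e}) v + 1 = dg M v"
proof -
  have "{e' \<in> M. v \<in> e'} = insert e {e' \<in> M - {e}. v \<in> e'}" using assms by auto
  then have "card {e' \<in> M. v \<in> e'} = Suc (card {e' \<in> M - {e}. v \<in> e'})"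
    using assms by simp
  then show ?thesis by (simp add: dg_def)
qed

lemma dg_ge_2E:
  assumes "finite M" "2 \<le> dg M v" "f \<in> M"
  obtains g where "g \<in> M" "g \<noteq> f" "v \<in> g"
proof -
  have "\<not> {e \<in> M. v \<in> e} \<subseteq> {f}"
  proof
    assume "{e \<in> M. v \<in> e} \<subseteq> {f}"
    then have "dg M v \<le> card {f}" unfolding dg_def by (intro card_mono) auto
    then show False using assms by simp
  qed
  then show ?thesis using that by blast
qed

lemma sum_dg:
  assumes "finite M" "finite K"
  shows "(\<Sum>v\<in>K. dg M v) = (\<Sum>e\<in>M. card (e \<inter> K))"
proof -
  have "(\<Sum>v\<in>K. dg M v) = (\<Sum>v\<in>K. \<Sum>e\<in>M. if v \<in> e then 1 else 0)"
    using assms by (simp add: dg_def sum.If_cases Int_def)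
  also have "\<dots> = (\<Sum>e\<in>M. \<Sum>v\<in>K. if v \<in> e then 1 else 0)" by (rule sum.swap)
  also have "\<dots> = (\<Sum>e\<in>M. card (e \<inter> K))"
    using assms by (simp add: sum.If_cases Int_def conj_commute)
  finally show ?thesis .
qed

section \<open>Partite edge sets with a codegree condition\<close>

text \<open>Edges form a plain set, since one copy of each edge suffices. A legal
  \<open>(r - 1)\<close>-set avoiding part \<open>j\<close> is encoded by a choice function
  \<open>x\<close>, of which only the values at the other parts count. The last assumption is the
  ceiling bound with the division cleared.\<close>

locale codegree_partite =
  fixes r t n d :: nat and P :: "nat \<Rightarrow> 'a set" and Es :: "'a set set"
  assumes r2: "2 \<le> r" and t2: "2 \<le> t"
    and finite_P: "\<And>i. i \<in> {1..r} \<Longrightarrow> finite (P i)"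
    and card_P: "\<And>i. i \<in> {1..r} \<Longrightarrow> card (P i) = n"
    and disjoint_P: "\<And>i k. i \<in> {1..r} \<Longrightarrow> k \<in> {1..r} \<Longrightarrow> i \<noteq> k \<Longrightarrow> P i \<inter> P k = {}"
    and edge_subset: "\<And>e. e \<in> Es \<Longrightarrow> e \<subseteq> (\<Union>i\<in>{1..r}. P i)"
    and edge_part: "\<And>e i. e \<in> Es \<Longrightarrow> i \<in> {1..r} \<Longrightarrow> \<exists>v. e \<inter> P i = {v}"
    and codegree: "\<And>x j. \<forall>i\<in>{1..r} - {j}. x i \<in> P i \<Longrightarrow> j \<in> {1..r} \<Longrightarrow>
      \<exists>N\<subseteq>P j. d + 1 \<le> card N \<and> (\<forall>w\<in>N. insert w (x ` ({1..r} - {j})) \<in> Es)"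
    \<comment> \<open>\<open>d\<close> is one less than the codegree\<close>
    and n_le: "n \<le> d * ((r - 1) * t + 1)"
begin

abbreviation R :: "nat set" where "R \<equiv> {1..r}"

definition V :: "'a set" where "V = (\<Union>i\<in>R. P i)"

definition pt :: "'a set \<Rightarrow> nat \<Rightarrow> 'a" where "pt e i = the_elem (e \<inter> P i)"

definition unc :: "'a set set \<Rightarrow> 'a set" where "unc M = {v \<in> V. dg M v = 0}"

text \<open>The weight \<open>r - 3/2\<close> of an edge lies strictly between \<open>r - 2\<close> and \<open>r - 1\<close>: an edge
  pays off iff at least \<open>r - 1\<close> vertices are covered by it alone.\<close>

definition cost :: "'a set set \<Rightarrow> nat" where
  "cost M = 2 * card (unc M) + (2 * r - 3) * card M"

lemma finite_V: "finite V"
  by (auto simp: V_def finite_P)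

lemma finite_unc [simp]: "finite (unc M)"
  using finite_V by (simp add: unc_def)

lemma finite_Es: "finite Es"
proof (rule finite_subset)
  show "Es \<subseteq> Pow V" using edge_subset by (auto simp: V_def)
qed (simp add: finite_V)

lemma P_subset_V: "i \<in> R \<Longrightarrow> P i \<subseteq> V"
  by (auto simp: V_def)

lemma V_cases:
  assumes "v \<in> V"
  obtains i where "i \<in> R" "v \<in> P i"
  using assms by (auto simp: V_def)

lemma P_unique: "i \<in> R \<Longrightarrow> k \<in> R \<Longrightarrow> v \<in> P i \<Longrightarrow> v \<in> P k \<Longrightarrow> i = k"
  using disjoint_P[of i k] by auto

lemma inj_on_parts: "K \<subseteq> R \<Longrightarrow> \<forall>k\<in>K. x k \<in> P k \<Longrightarrow> inj_on x K"
  by (rule inj_onI) (metis P_unique subsetD)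

lemma Int_pt:
  assumes "e \<in> Es" "i \<in> R"
  shows "e \<inter> P i = {pt e i}"
proof -
  obtain v where "e \<inter> P i = {v}" using edge_part[OF assms] by (elim exE)
  then show ?thesis by (simp only: pt_def the_elem_eq)
qed

lemma pt_in:
  assumes "e \<in> Es" "i \<in> R"
  shows "pt e i \<in> e" "pt e i \<in> P i"
  using Int_pt[OF assms] by auto

lemma pt_eq: "e \<in> Es \<Longrightarrow> i \<in> R \<Longrightarrow> v \<in> e \<Longrightarrow> v \<in> P i \<Longrightarrow> v = pt e i"
  using Int_pt[of e i] by auto

lemma edge_cases:
  assumes "e \<in> Es" "v \<in> e"
  obtains i where "i \<in> R" "v = pt e i" "v \<in> P i"
proof -
  from edge_subset[OF assms(1)] assms(2) obtain i where "i \<in> R" "v \<in> P i" by auto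
  with pt_eq[OF assms(1)] assms(2) show ?thesis by (intro that)
qed

lemma edge_image:
  assumes "e \<in> Es"
  shows "e = pt e ` R"
proof
  show "e \<subseteq> pt e ` R"
  proof
    fix v assume "v \<in> e"
    with assms obtain i where "i \<in> R" "v = pt e i" by (rule edge_cases)
    then show "v \<in> pt e ` R" by blast
  qed
qed (use pt_in(1)[OF assms] in blast)

lemma finite_edge: "e \<in> Es \<Longrightarrow> finite e"
  by (metis edge_image finite_atLeastAtMost finite_imageI)

lemma card_edge: "e \<in> Es \<Longrightarrow> card e \<le> r"
  by (metis edge_image card_image_le card_atLeastAtMost diff_Suc_1 finite_atLeastAtMost)

text \<open>Double counting of incidences: every edge has exactly one vertex in part
  \<open>k\<close>.\<close>

lemma sum_dg_part:
  assumes "M \<subseteq> Es" "k \<in> R"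
  shows "(\<Sum>v\<in>P k. dg M v) = card M"
proof -
  have "finite M" using assms finite_Es finite_subset by blast
  then have "(\<Sum>v\<in>P k. dg M v) = (\<Sum>e\<in>M. card (e \<inter> P k))" using finite_P assms by (intro sum_dg) auto
  also have "\<dots> = (\<Sum>e\<in>M. 1)" using assms Int_pt by (intro sum.cong) auto
  finally show ?thesis by simp
qed

text \<open>Truncated subtraction makes an uncovered vertex contribute \<open>0\<close> instead of
  \<open>-1\<close>; this correction gives the last summand. Integers are used because
  \<open>card M\<close> may be below \<open>n\<close>.\<close>

lemma excess:
  assumes "M \<subseteq> Es" "k \<in> R"
  shows "int (\<Sum>v\<in>P k. dg M v - 1) = int (card M) - int n + int (card (unc M \<inter> P k))"
proof -
  have "(\<Sum>v\<in>P k. int (dg M v - 1)) = (\<Sum>v\<in>P k. int (dg M v) - 1 + (if dg M v = 0 then 1 else 0))"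
    by (intro sum.cong) auto
  also have "\<dots> = int (\<Sum>v\<in>P k. dg M v) - int (card (P k)) + int (card {v \<in> P k. dg M v = 0})"
    using finite_P[OF assms(2)] by (simp add: sum.distrib sum_subtractf sum.If_cases Int_def)
  also have "{v \<in> P k. dg M v = 0} = unc M \<inter> P k"
    using P_subset_V[OF assms(2)] by (auto simp: unc_def)
  finally show ?thesis using sum_dg_part[OF assms] card_P[OF assms(2)] by simp
qed

lemma card_unc: "card (unc M) = (\<Sum>k\<in>R. card (unc M \<inter> P k))"
proof -
  have "unc M = (\<Union>k\<in>R. unc M \<inter> P k)" by (auto simp: unc_def V_def)
  then have "card (unc M) = card (\<Union>k\<in>R. unc M \<inter> P k)" by (rule arg_cong)
  also have "\<dots> = (\<Sum>k\<in>R. card (unc M \<inter> P k))"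
  proof (rule card_UN_disjoint)
    show "\<forall>i\<in>R. \<forall>j\<in>R. i \<noteq> j \<longrightarrow> (unc M \<inter> P i) \<inter> (unc M \<inter> P j) = {}"
    proof (intro ballI impI)
      fix i j assume "i \<in> R" "j \<in> R" "i \<noteq> j"
      from disjoint_P[OF this] show "(unc M \<inter> P i) \<inter> (unc M \<inter> P j) = {}" by auto
    qed
  qed auto
  finally show ?thesis .
qed

lemma ex_optimal:
  obtains M where "M \<subseteq> Es" "\<And>v. dg M v \<le> t"
    "\<And>M'. M' \<subseteq> Es \<Longrightarrow> (\<And>v. dg M' v \<le> t) \<Longrightarrow> cost M \<le> cost M'"
proof -
  have "{} \<subseteq> Es \<and> (\<forall>v. dg {} v \<le> t)" by (simp add: dg_def)
  from ex_has_least_nat[of "\<lambda>M. M \<subseteq> Es \<and> (\<forall>v. dg M v \<le> t)", OF this, of cost]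
  obtain M where M: "M \<subseteq> Es" "\<forall>v. dg M v \<le> t"
    "\<forall>M'. M' \<subseteq> Es \<and> (\<forall>v. dg M' v \<le> t) \<longrightarrow> cost M \<le> cost M'"
    by (elim exE conjE)
  show ?thesis by (rule that[of M]) (use M in simp_all)
qed

end

section \<open>Star structure of a family of least cost\<close>

locale optimal_family = codegree_partite +
  fixes M
  assumes M_sub: "M \<subseteq> Es" and M_shallow: "\<And>v. dg M v \<le> t"
    and M_opt: "\<And>M'. M' \<subseteq> Es \<Longrightarrow> (\<And>v. dg M' v \<le> t) \<Longrightarrow> cost M \<le> cost M'"
begin

lemma finite_M: "finite M"
  using M_sub finite_Es finite_subset by blast

lemma M_Es: "e \<in> M \<Longrightarrow> e \<in> Es"
  using M_sub by blast

text \<open>Otherwise dropping \<open>e\<close> would uncover at most \<open>r - 2\<close> vertices,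
  so the cost would rise by at most \<open>2 * r - 4\<close> for them and fall by
  \<open>2 * r - 3\<close> for the edge.\<close>

lemma unique_center:
  assumes e: "e \<in> M" "a \<in> e" "b \<in> e" and a: "2 \<le> dg M a" and b: "2 \<le> dg M b"
  shows "a = b"
proof (rule ccontr)
  assume "a \<noteq> b"
  let ?M = "M - {e}"
  have eE: "e \<in> Es" using e M_Es by blast
  have "unc ?M \<subseteq> unc M \<union> (e - {a, b})"
  proof
    fix z assume z: "z \<in> unc ?M"
    show "z \<in> unc M \<union> (e - {a, b})"
    proof (cases "z \<in> e")
      case True
      then have "dg ?M z + 1 = dg M z" by (intro dg_remove finite_M e)
      then have "dg M z = 1" using z by (simp add: unc_def)
      then show ?thesis using a b True by auto
    next
      case False
      then have "{e' \<in> M - {e}. z \<in> e'} = {e' \<in> M. z \<in> e'}" by auto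
      then show ?thesis using z by (simp add: unc_def dg_def)
    qed
  qed
  then have "card (unc ?M) \<le> card (unc M \<union> (e - {a, b}))"
    using finite_edge[OF eE] by (intro card_mono) auto
  also have "\<dots> \<le> card (unc M) + card (e - {a, b})" by (rule card_Un_le)
  also have "card (e - {a, b}) = card e - 2"
    using e \<open>a \<noteq> b\<close> finite_edge[OF eE] by (subst card_Diff_subset) auto
  finally have u: "card (unc ?M) \<le> card (unc M) + (r - 2)" using card_edge[OF eE] by linarith
  have m: "card M = card ?M + 1" using card_Suc_Diff1[OF finite_M e(1)] by simp
  have "cost M \<le> cost ?M"
  proof (rule M_opt)
    show "dg ?M v \<le> t" for v
      using dg_mono[OF finite_M, of ?M v] M_shallow[of v] by auto
  qed (use M_sub in auto)
  moreover have "cost M = 2 * card (unc M) + (2 * r - 3) * card ?M + (2 * r - 3)"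
    unfolding cost_def by (subst m) (simp only: distrib_left mult_1_right add.assoc)
  moreover have "cost ?M = 2 * card (unc ?M) + (2 * r - 3) * card ?M"
    by (simp only: cost_def)
  ultimately show False using u r2 by linarith
qed

lemma sum_dg_le:
  assumes "finite K" "\<And>e a b. e \<in> M \<Longrightarrow> a \<in> e \<Longrightarrow> b \<in> e \<Longrightarrow> a \<in> K \<Longrightarrow> b \<in> K \<Longrightarrow> a = b"
  shows "(\<Sum>v\<in>K. dg M v) \<le> card M"
proof -
  have "card (e \<inter> K) \<le> 1" if "e \<in> M" for e
    using assms that by (auto simp: card_le_Suc0_iff_eq)
  then have "(\<Sum>e\<in>M. card (e \<inter> K)) \<le> (\<Sum>e\<in>M. 1)" by (intro sum_mono) auto
  then show ?thesis using sum_dg[OF finite_M assms(1)] by simp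
qed

definition exc :: "nat \<Rightarrow> nat" where "exc k = (\<Sum>v\<in>P k. dg M v - 1)"

text \<open>The covered vertices left out are exactly the leaves of stars with at least two
  edges.\<close>

definition core :: "nat \<Rightarrow> 'a set" where
  "core k = {w \<in> P k. 1 \<le> dg M w \<and> (\<forall>e\<in>M. w \<in> e \<longrightarrow> (\<forall>c\<in>e. c \<noteq> w \<longrightarrow> dg M c = 1))}"

lemma int_exc: "k \<in> R \<Longrightarrow> int (exc k) = int (card M) - int n + int (card (unc M \<inter> P k))"
  unfolding exc_def by (rule excess[OF M_sub])

lemma finite_core: "k \<in> R \<Longrightarrow> finite (core k)"
  using finite_P[of k] by (simp add: core_def)

text \<open>Every edge of \<open>M\<close> contains at most one vertex that is in \<open>core j\<close> or has degree at least 2;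
  the bound is the resulting count of edges.\<close>

lemma weight:
  assumes j: "j \<in> R"
  shows "t * (\<Sum>k\<in>R. exc k) + (\<Sum>w\<in>core j. t - dg M w) \<le> (t - 1) * card M"
proof -
  define K where "K = core j \<union> {v \<in> V. 2 \<le> dg M v}"
  have core_V: "core j \<subseteq> V" using P_subset_V[OF j] by (auto simp: core_def)
  have K_V: "K \<subseteq> V" using core_V by (auto simp: K_def)
  have finK: "finite K" using K_V finite_V by (rule finite_subset)
  have *: "a = b" if e: "e \<in> M" "a \<in> e" "b \<in> e" and ab: "a \<in> K" "b \<in> K" for e a b
  proof (rule ccontr)
    assume "a \<noteq> b"
    \<comment> \<open>On an edge of \<open>M\<close> the partner of a core vertex has degree 1, so
      it can be in \<open>K\<close> only through \<open>core j\<close>. But \<open>core j\<close>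
      lies in one part, which the edge meets once. Hence both vertices have degree at least
      2.\<close>
    have "b \<in> core j" if "a \<in> core j" "b \<in> K" "a \<in> e" "b \<in> e" "b \<noteq> a" for a b
    proof -
      have "dg M b = 1" using that e(1) by (auto simp: core_def)
      then show ?thesis using that(2) by (simp add: K_def)
    qed
    then have "a \<in> core j \<longleftrightarrow> b \<in> core j" using \<open>a \<noteq> b\<close> e ab by metis
    moreover have "\<not> (a \<in> core j \<and> b \<in> core j)"
    proof
      assume "a \<in> core j \<and> b \<in> core j"
      then have "a \<in> P j" "b \<in> P j" by (simp_all add: core_def)
      then show False using pt_eq[OF M_Es[OF e(1)] j] e \<open>a \<noteq> b\<close> by metis
    qed
    ultimately have "2 \<le> dg M a" "2 \<le> dg M b" using ab by (auto simp: K_def)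
    then show False using unique_center[OF e] \<open>a \<noteq> b\<close> by simp
  qed
  have "(\<Sum>k\<in>R. exc k) = (\<Sum>v\<in>V. dg M v - 1)"
    unfolding exc_def V_def
    by (rule sum.UNION_disjoint[symmetric]) (use finite_P disjoint_P in simp_all)
  also have "\<dots> = (\<Sum>v\<in>K. dg M v - 1)"
    by (rule sum.mono_neutral_right) (use finite_V K_V in \<open>auto simp: K_def\<close>)
  finally have exc: "(\<Sum>k\<in>R. exc k) = (\<Sum>v\<in>K. dg M v - 1)" .
  have def: "(\<Sum>w\<in>core j. t - dg M w) = (\<Sum>v\<in>K. if v \<in> core j then t - dg M v else 0)"
    by (rule sum.mono_neutral_cong_left) (use finK in \<open>auto simp: K_def\<close>)
  have "t * (\<Sum>k\<in>R. exc k) + (\<Sum>w\<in>core j. t - dg M w)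
      = (\<Sum>v\<in>K. t * (dg M v - 1) + (if v \<in> core j then t - dg M v else 0))"
    by (simp only: exc def sum_distrib_left sum.distrib)
  \<comment> \<open>For \<open>x = dg M v\<close> one has
    \<open>t * (x - 1) + (t - x) = (t - 1) * x\<close>: equality at core vertices, and
    \<open>x \<le> t\<close> gives the inequality elsewhere.\<close>
  also have "\<dots> \<le> (\<Sum>v\<in>K. (t - 1) * dg M v)"
  proof (rule sum_mono)
    fix v assume "v \<in> K"
    then have "1 \<le> dg M v" by (auto simp: K_def core_def)
    then obtain a where a: "dg M v = Suc a" by (cases "dg M v") auto
    obtain s where s: "t = dg M v + s" using M_shallow[of v] le_Suc_ex by blast
    show "t * (dg M v - 1) + (if v \<in> core j then t - dg M v else 0) \<le> (t - 1) * dg M v"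
      by (simp add: s a algebra_simps)
  qed
  also have "\<dots> = (t - 1) * (\<Sum>v\<in>K. dg M v)" by (simp only: sum_distrib_left)
  also have "\<dots> \<le> (t - 1) * card M"
    by (intro mult_left_mono sum_dg_le finK) (use * in auto)
  finally show ?thesis .
qed

section \<open>Local improvements: adding and exchanging edges\<close>

text \<open>If \<open>w\<close> had room, the new edge could be added to \<open>M\<close>. It covers
  at least \<open>r - 1\<close> new vertices, which lowers the cost by \<open>2 * r - 2\<close> and
  exceeds the price \<open>2 * r - 3\<close> of an edge.\<close>

lemma saturated:
  assumes j: "j \<in> R" and x: "\<forall>k\<in>R - {j}. x k \<in> unc M \<inter> P k"
    and w: "w \<in> P j" and y: "insert w (x ` (R - {j})) \<in> Es"
  shows "dg M w = t"
proof (rule ccontr)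
  assume "dg M w \<noteq> t"
  then have wt: "dg M w < t" using M_shallow[of w] by simp
  define y where "y = insert w (x ` (R - {j}))"
  have x0: "dg M (x k) = 0" if "k \<in> R - {j}" for k using x that by (auto simp: unc_def)
  have inj: "inj_on x (R - {j})" by (rule inj_on_parts) (use x in auto)
  have cx: "card (x ` (R - {j})) = r - 1" using card_image[OF inj] j by simp
  with r2 have "card (x ` (R - {j})) \<noteq> 0" by linarith
  then have "x ` (R - {j}) \<noteq> {}" by (metis card.empty)
  then obtain k where k: "k \<in> R - {j}" by blast
  then have "y \<notin> M" using x0[OF k] dg_eq_0_iff[OF finite_M] by (auto simp: y_def)
  let ?M = "insert y M"
  have "cost M \<le> cost ?M"
  proof (rule M_opt)
    show "?M \<subseteq> Es" using M_sub assms by (simp add: y_def)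
    show "dg ?M v \<le> t" for v
    proof (cases "v \<in> y")
      case True
      then have "v = w \<or> (\<exists>k\<in>R - {j}. v = x k)" unfolding y_def by blast
      then have "v = w \<or> dg M v = 0" using x0 by metis
      then have "dg M v + 1 \<le> t" using wt t2 by auto
      then show ?thesis using dg_insert_le[OF finite_M, of y v] True by simp
    next
      case False
      then show ?thesis using dg_insert_le[OF finite_M, of y v] M_shallow[of v] by simp
    qed
  qed
  have "unc ?M \<subseteq> unc M - x ` (R - {j})"
  proof
    fix z assume z: "z \<in> unc ?M"
    have "dg M z \<le> dg ?M z" by (rule dg_mono) (use finite_M in auto)
    moreover have "z \<notin> y"
      using z dg_pos[of ?M y z] finite_M by (auto simp: unc_def)
    ultimately show "z \<in> unc M - x ` (R - {j})" using z by (auto simp: unc_def y_def)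
  qed
  then have "card (unc ?M) \<le> card (unc M - x ` (R - {j}))" by (intro card_mono) auto
  also have "\<dots> = card (unc M) - (r - 1)"
    using cx x by (subst card_Diff_subset) auto
  finally have u: "card (unc ?M) \<le> card (unc M) - (r - 1)" .
  have "r - 1 \<le> card (unc M)"
    unfolding cx[symmetric] by (rule card_mono) (use x in auto)
  moreover have "cost ?M = 2 * card (unc ?M) + (2 * r - 3) * card M + (2 * r - 3)"
    using \<open>y \<notin> M\<close> finite_M by (simp add: cost_def)
  moreover have "cost M = 2 * card (unc M) + (2 * r - 3) * card M" by (simp add: cost_def)
  ultimately show False using u r2 \<open>cost M \<le> cost ?M\<close> by linarith
qed

lemma exchange_core:
  assumes J: "J \<subseteq> R" "i \<in> J" and j: "j \<in> R" "j \<notin> J"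
    and f: "f \<in> M" "h \<in> f" "h \<in> P i" and g0: "g0 \<in> M" "g0 \<noteq> f" "h \<in> g0"
    and xJ: "\<forall>k\<in>J. x k \<in> unc M \<inter> P k" and xf: "\<forall>k\<in>R - J - {j}. x k = pt f k"
    and w: "w \<in> P j" "w \<notin> g0" and yE: "insert w (x ` (R - {j})) \<in> Es"
  shows "w \<in> core j"
proof (rule ccontr)
  assume ncore: "w \<notin> core j"
  define y where "y = insert w (x ` (R - {j}))"
  \<comment> \<open>The vertices of \<open>f\<close> that may lose their cover. Part
    \<open>i\<close> is left out because \<open>g0\<close> still covers \<open>h\<close>.\<close>
  define T where "T = pt f ` insert j (J - {i})"
  have fE: "f \<in> Es" using f M_Es by blast
  have iR: "i \<in> R" using J by blast
  have finJ: "finite J" using J finite_subset by blast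
  have x0: "dg M (x k) = 0" if "k \<in> J" for k using xJ that by (auto simp: unc_def)
  have Jj: "J \<subseteq> R - {j}" using J j by blast
  have xy: "x k \<in> y" if "k \<in> J" for k using that Jj by (auto simp: y_def)
  have yM: "y \<notin> M" using xy[OF J(2)] x0[OF J(2)] dg_pos[OF finite_M, of y "x i"] by auto
  have dg0: "x k \<in> f" if "k \<in> R - J - {j}" for k
    using xf that pt_in(1)[OF fE] by auto
  have cT: "card T \<le> card J"
  proof -
    have "card T \<le> card (insert j (J - {i}))" unfolding T_def by (rule card_image_le) (use finJ in simp)
    also have "\<dots> = Suc (card (J - {i}))" using finJ j by (subst card_insert_disjoint) auto
    also have "\<dots> = card J" using finJ J(2) by (rule card_Suc_Diff1)
    finally show ?thesis .
  qed
  have finT: "finite T" using finJ by (simp add: T_def)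
  have cxJ: "card (x ` J) = card J"
    by (intro card_image inj_on_parts J(1)) (use xJ in auto)
  have xJ_sub: "x ` J \<subseteq> unc M" using xJ by auto
  have "card J \<le> card (unc M)" unfolding cxJ[symmetric] by (intro card_mono finite_unc xJ_sub)
  have cU: "card (unc M - x ` J) = card (unc M) - card J"
    using xJ_sub cxJ finJ by (subst card_Diff_subset) auto
  have fcase: "z \<in> T" if z: "z \<in> f" "z \<notin> y" "z \<noteq> h" for z
  proof -
    from fE z(1) obtain k where k: "k \<in> R" "z = pt f k" "z \<in> P k" by (rule edge_cases)
    have "k \<noteq> i"
      using z(3) k(2) pt_eq[OF fE iR f(2,3)] by auto
    moreover have "k \<in> insert j J"
    proof (rule ccontr)
      assume "k \<notin> insert j J"
      then have "k \<in> R - J - {j}" using k by simp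
      then have "x k = z" "x k \<in> x ` (R - {j})" using xf k(2) by (simp, blast)
      then have "x k = z" "x k \<in> y" by (simp_all add: y_def)
      then show False using z(2) by simp
    qed
    ultimately show ?thesis using k(2) by (auto simp: T_def)
  qed
  have in_y: "dg M v = 0 \<or> v \<in> f \<or> v = w" if "v \<in> y" for v
  proof -
    from that consider "v = w" | k where "k \<in> R - {j}" "v = x k" unfolding y_def by blast
    then show ?thesis
    proof cases
      case 2
      then show ?thesis using x0[of k] dg0[of k] by (cases "k \<in> J") simp_all
    qed simp
  qed
  \<comment> \<open>Among the vertices of \<open>y\<close>, uncovered ones rise to degree 1, those
    in \<open>f\<close> lose \<open>f\<close> first, and \<open>w\<close> rises to at most 2, which
    \<open>2 \<le> t\<close> permits.\<close>
  have shallow: "dg (insert y (M - G)) v \<le> t" if G: "f \<in> G" and wG: "dg M w \<le> 1" for G v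
  proof -
    have fin: "finite (M - G)" using finite_M by simp
    have le: "dg (M - G) v \<le> dg M v" by (rule dg_mono) (use finite_M in auto)
    have le_f: "dg (M - G) v + 1 \<le> dg M v" if "v \<in> f"
    proof -
      have "dg (M - G) v \<le> dg (M - {f}) v" by (rule dg_mono) (use finite_M G in auto)
      then show ?thesis using dg_remove[OF finite_M f(1) that] by simp
    qed
    show ?thesis
    proof (cases "v \<in> y")
      case True
      then have "dg (insert y (M - G)) v \<le> dg (M - G) v + 1" using dg_insert_le[OF fin, of y v] by simp
      then show ?thesis using in_y[OF True] le le_f wG t2 M_shallow[of v] by auto
    next
      case False
      then show ?thesis using dg_insert_le[OF fin, of y v] le M_shallow[of v] by simp
    qed
  qed
  have sub: "insert y (M - G) \<subseteq> Es" for G using M_sub yE by (auto simp: y_def)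
  \<comment> \<open>A vertex of \<open>f\<close> with degree at least 2 must be \<open>h\<close>,
    which lies on \<open>g0\<close>, unlike \<open>w\<close>.\<close>
  have dg_w: "dg M w \<le> 1" if "w \<in> f"
  proof (rule ccontr)
    assume "\<not> dg M w \<le> 1"
    moreover have "2 \<le> dg M h"
      using dg_remove[OF finite_M f(1,2)] dg_pos[of "M - {f}" g0 h] g0 finite_M by simp
    ultimately have "w = h" using unique_center[OF f(1) that f(2)] by simp
    then show False using w g0 by simp
  qed
  have not_y: "z \<notin> y" if "z \<in> unc (insert y (M - G))" for z G
    using that dg_pos[of "insert y (M - G)" y z] finite_M by (auto simp: unc_def)
  have left: "e \<in> G" if "z \<in> unc (insert y (M - G))" "e \<in> M" "z \<in> e" for z e G
    using that dg_pos[of "insert y (M - G)" e z] finite_M by (auto simp: unc_def)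
  have costM: "cost M = 2 * card (unc M) + (2 * r - 3) * card M" by (simp only: cost_def)
  \<comment> \<open>exchange \<open>f\<close> for \<open>y\<close>; if \<open>w\<close> is a leaf of another star edge \<open>g\<close>, also drop \<open>g\<close>\<close>
  show False
  proof (cases "dg M w = 0 \<or> w \<in> f")
    case True
    let ?M = "insert y (M - {f})"
    have w1: "dg M w \<le> 1" using True dg_w by auto
    have "unc ?M \<subseteq> (unc M - x ` J - {w}) \<union> (T - {w})"
    proof
      fix z assume z: "z \<in> unc ?M"
      have zy: "z \<notin> y" using not_y[OF z] .
      have zw: "z \<noteq> w" using zy by (auto simp: y_def)
      show "z \<in> (unc M - x ` J - {w}) \<union> (T - {w})"
      proof (cases "dg M z = 0")
        case True
        then have "z \<in> unc M" using z by (simp add: unc_def)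
        then show ?thesis using zy zw xy by auto
      next
        case False
        then obtain e where e: "e \<in> M" "z \<in> e" by (rule dg_nonzeroE[OF finite_M])
        then have "z \<in> f" using left[OF z e] by simp
        moreover have "z \<noteq> h" using left[OF z g0(1)] g0(2,3) by auto
        ultimately show ?thesis using fcase zy zw by auto
      qed
    qed
    then have "card (unc ?M) \<le> card ((unc M - x ` J - {w}) \<union> (T - {w}))"
      using finT by (intro card_mono) auto
    also have "\<dots> \<le> card (unc M - x ` J - {w}) + card (T - {w})" by (rule card_Un_le)
    \<comment> \<open>The strict gain is \<open>w\<close> itself: either it was uncovered and now is
      not, or it is the member \<open>pt f j\<close> of \<open>T\<close> and keeps a cover.\<close>
    also have "\<dots> < card (unc M)"
    proof (cases "dg M w = 0")
      case True
      have "w \<notin> x ` J"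
      proof
        assume "w \<in> x ` J"
        then obtain k where k: "k \<in> J" "w = x k" by (elim imageE)
        then have "k \<in> R" "w \<in> P k" using J(1) xJ by (auto simp only: subset_iff)
        then have "j = k" using P_unique[OF j(1)] w(1) by metis
        then show False using j(2) k(1) by simp
      qed
      then have "w \<in> unc M - x ` J" using True w(1) P_subset_V[OF j(1)] by (auto simp: unc_def)
      then have "card (unc M - x ` J - {w}) < card (unc M - x ` J)"
        by (intro card_Diff1_less) auto
      moreover have "card (T - {w}) \<le> card J" using cT card_mono[OF finT, of "T - {w}"] by auto
      ultimately show ?thesis using cU \<open>card J \<le> card (unc M)\<close> by linarith
    next
      case False
      then have "w \<in> f" using True by simp
      then have "w = pt f j" using pt_eq[OF fE j(1)] w by simp
      then have "w \<in> T" by (simp add: T_def)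
      then have "card (T - {w}) < card T" using finT by (intro card_Diff1_less) auto
      moreover have "card (unc M - x ` J - {w}) \<le> card (unc M - x ` J)" by (intro card_mono) auto
      ultimately show ?thesis using cU cT \<open>card J \<le> card (unc M)\<close> by linarith
    qed
    finally have "card (unc ?M) < card (unc M)" .
    moreover have "card ?M = card M"
      using yM finite_M card_Suc_Diff1[OF finite_M f(1)] by (subst card_insert_disjoint) auto
    ultimately have "cost ?M < cost M" by (simp add: cost_def)
    moreover have "cost M \<le> cost ?M" by (intro M_opt sub shallow w1) simp
    ultimately show False by linarith
  next
    case False
    then have "\<exists>g\<in>M. w \<in> g \<and> (\<exists>c\<in>g. c \<noteq> w \<and> dg M c \<noteq> 1)"
      using ncore w(1) by (auto simp: core_def)
    then obtain g c where g: "g \<in> M" "w \<in> g" and c: "c \<in> g" "c \<noteq> w" "dg M c \<noteq> 1" by blast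
    have c2: "2 \<le> dg M c" using c(3) dg_pos[OF finite_M g(1) c(1)] by simp
    have w1: "dg M w \<le> 1" using unique_center[OF g c(1)] c c2 by force
    have gf: "g \<noteq> f" using False g by auto
    let ?M = "insert y (M - {f, g})"
    have "unc ?M \<subseteq> ((unc M - x ` J) \<union> T) \<union> (g - {w, c})"
    proof
      fix z assume z: "z \<in> unc ?M"
      have zy: "z \<notin> y" using not_y[OF z] .
      have zw: "z \<noteq> w" using zy by (auto simp: y_def)
      \<comment> \<open>\<open>g0\<close> survives: it differs from \<open>f\<close>, and from
        \<open>g\<close> because \<open>w\<close> lies in \<open>g\<close> only.\<close>
      have "z \<noteq> h" using left[OF z g0(1)] g0 w(2) g(2) by auto
      show "z \<in> ((unc M - x ` J) \<union> T) \<union> (g - {w, c})"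
      proof (cases "dg M z = 0 \<or> z \<in> f")
        case True
        then show ?thesis using fcase[OF _ zy \<open>z \<noteq> h\<close>] z zy xy by (auto simp: unc_def)
      next
        case False
        then have "dg M z \<noteq> 0" by simp
        then obtain e where e: "e \<in> M" "z \<in> e" by (rule dg_nonzeroE[OF finite_M])
        then have "z \<in> g" using left[OF z e] False by auto
        \<comment> \<open>The centre \<open>c\<close> has a second edge, which survives unless it is
          \<open>f\<close>; here \<open>z\<close> is not in \<open>f\<close>.\<close>
        moreover have "z \<noteq> c"
        proof
          assume "z = c"
          obtain g' where "g' \<in> M" "g' \<noteq> g" "c \<in> g'" using dg_ge_2E[OF finite_M c2 g(1)] .
          then have "g' = f" using left[OF z, of g'] \<open>z = c\<close> by auto
          then show False using False \<open>c \<in> g'\<close> \<open>z = c\<close> by simp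
        qed
        ultimately show ?thesis using zw by auto
      qed
    qed
    have gE: "g \<in> Es" using g M_Es by blast
    have "card (unc ?M) \<le> card (((unc M - x ` J) \<union> T) \<union> (g - {w, c}))"
      using finT finite_edge[OF gE] by (intro card_mono \<open>unc ?M \<subseteq> _\<close>) auto
    also have "\<dots> \<le> card ((unc M - x ` J) \<union> T) + card (g - {w, c})" by (rule card_Un_le)
    also have "card ((unc M - x ` J) \<union> T) \<le> card (unc M - x ` J) + card T" by (rule card_Un_le)
    also have "card (g - {w, c}) = card g - 2"
      using g(2) c finite_edge[OF gE] by (subst card_Diff_subset) auto
    finally have "card (unc ?M) \<le> card (unc M - x ` J) + card T + (card g - 2)" by simp
    then have u: "card (unc ?M) \<le> card (unc M) + (r - 2)"
      using cU cT \<open>card J \<le> card (unc M)\<close> card_edge[OF gE] by linarith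
    have fin: "finite (M - {f, g})" using finite_M by simp
    have "card ?M = Suc (card (M - {f, g}))" using yM fin by (subst card_insert_disjoint) auto
    also have "card (M - {f, g}) = card M - 2"
      using f(1) g(1) gf by (subst card_Diff_subset) auto
    finally have m: "card ?M = Suc (card M - 2)" .
    have "card {f, g} \<le> card M" using f(1) g(1) finite_M by (intro card_mono) auto
    then have m: "card M = card ?M + 1" using m gf by simp
    have "cost M \<le> cost ?M" by (intro M_opt sub shallow w1) simp
    moreover have "cost M = 2 * card (unc M) + (2 * r - 3) * card ?M + (2 * r - 3)"
      unfolding cost_def by (subst m) (simp only: distrib_left mult_1_right add.assoc)
    moreover have "cost ?M = 2 * card (unc ?M) + (2 * r - 3) * card ?M" by (simp only: cost_def)
    ultimately show False using u r2 by linarith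
  qed
qed

section \<open>Covered parts, star edges and core neighbours\<close>

text \<open>Otherwise take a part \<open>j\<close> of least excess and uncovered vertices in all
  other parts. Their \<open>d + 1\<close> neighbours are saturated, so \<open>exc j\<close> is at
  least \<open>(t - 1) * (d + 1)\<close>, whereas \<open>weight\<close> and minimality give at most
  \<open>(t - 1) * d\<close>.\<close>

lemma some_part_covered: "\<exists>k\<in>R. unc M \<inter> P k = {}"
proof (rule ccontr)
  assume neg: "\<not> (\<exists>k\<in>R. unc M \<inter> P k = {})"
  then have "\<forall>k\<in>R. \<exists>u. u \<in> unc M \<inter> P k" by auto
  then obtain x where x: "\<forall>k\<in>R. x k \<in> unc M \<inter> P k" by (rule bchoice[THEN exE])
  have "R \<noteq> {}" using r2 by simp
  then obtain j where j: "j \<in> R" and min: "\<And>k. k \<in> R \<Longrightarrow> exc j \<le> exc k"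
    using arg_min_least[of R _ exc] arg_min_if_finite(1)[of R exc] by auto
  obtain N where N: "N \<subseteq> P j" "d + 1 \<le> card N" "\<forall>w\<in>N. insert w (x ` (R - {j})) \<in> Es"
    using codegree[of j x] x j by auto
  have sat: "dg M w = t" if "w \<in> N" for w
    by (rule saturated[OF j, of x]) (use x N that in auto)
  have "(t - 1) * (d + 1) \<le> (t - 1) * card N" using N(2) by (rule mult_left_mono) simp
  also have "\<dots> = (\<Sum>w\<in>N. dg M w - 1)" using sat by simp
  also have "\<dots> \<le> exc j"
    unfolding exc_def by (rule sum_mono2) (use finite_P[OF j] N in auto)
  finally have large: "(t - 1) * (d + 1) \<le> exc j" .
  have "(\<Sum>k\<in>R. exc j) \<le> (\<Sum>k\<in>R. exc k)" by (rule sum_mono) (rule min)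
  then have "t * (r * exc j) \<le> t * (\<Sum>k\<in>R. exc k)" by (intro mult_left_mono) simp_all
  also have "\<dots> \<le> (t - 1) * card M" using weight[OF j] by linarith
  also have "\<dots> \<le> (t - 1) * (exc j + n)" using int_exc[OF j] by (intro mult_left_mono) linarith+
  finally have "t * (r * exc j) \<le> (t - 1) * (exc j + n)" .
  moreover obtain r' t' where rt: "r = Suc r'" "t = Suc t'" using r2 t2 by (cases r; cases t) auto
  \<comment> \<open>Moving \<open>(t - 1) * exc j\<close> to the left leaves the factor
    \<open>r * t - (t - 1)\<close>, the denominator of the codegree bound.\<close>
  ultimately have "((r - 1) * t + 1) * exc j \<le> (t - 1) * n" by (simp add: algebra_simps)
  also have "\<dots> \<le> (t - 1) * (d * ((r - 1) * t + 1))" using n_le by (rule mult_left_mono) simp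
  finally have "((r - 1) * t + 1) * exc j \<le> ((r - 1) * t + 1) * ((t - 1) * d)" by (simp only: ac_simps)
  then have "exc j \<le> (t - 1) * d" by (subst (asm) mult_le_cancel1) simp
  then show False using large t2 by simp
qed

text \<open>In a fully covered part the excess, a natural number, equals \<open>card M\<close> minus
  \<open>n\<close>.\<close>

lemma n_le_card_M: "n \<le> card M"
proof -
  obtain k where k: "k \<in> R" "unc M \<inter> P k = {}" using some_part_covered by (elim bexE)
  have "int (exc k) = int (card M) - int n" using int_exc[OF k(1)] k(2) by simp
  then show ?thesis by linarith
qed

definition ctr :: "nat \<Rightarrow> 'a set set" where
  "ctr i = {f \<in> M. \<exists>h\<in>f \<inter> P i. 2 \<le> dg M h}"

text \<open>As \<open>n \<le> card M\<close>, the excess of part \<open>i\<close> is at least the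
  number of its uncovered vertices, and a centre contributes more edges than excess. This allows a
  separate star edge to be reserved for each uncovered vertex.\<close>

lemma card_ctr:
  assumes i: "i \<in> R"
  shows "card (unc M \<inter> P i) \<le> card (ctr i)"
proof -
  have "int (card (unc M \<inter> P i)) \<le> int (exc i)" using int_exc[OF i] n_le_card_M by linarith
  moreover have "exc i \<le> (\<Sum>v\<in>P i. dg (ctr i) v)"
    unfolding exc_def
  proof (rule sum_mono)
    fix v assume "v \<in> P i"
    show "dg M v - 1 \<le> dg (ctr i) v"
    proof (cases "2 \<le> dg M v")
      case True
      then have "{e \<in> ctr i. v \<in> e} = {e \<in> M. v \<in> e}" using \<open>v \<in> P i\<close> by (auto simp: ctr_def)
      then show ?thesis by (simp add: dg_def)
    qed simp
  qed
  moreover have "(\<Sum>v\<in>P i. dg (ctr i) v) = card (ctr i)"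
    by (rule sum_dg_part[OF _ i]) (use M_sub in \<open>auto simp: ctr_def\<close>)
  ultimately show ?thesis by linarith
qed

text \<open>An edge has at most one centre; so edges reserved for different parts are
  distinct.\<close>

lemma ctr_unique:
  assumes "f \<in> ctr i" "f \<in> ctr k" "i \<in> R" "k \<in> R"
  shows "i = k"
proof -
  obtain a where a: "f \<in> M" "a \<in> f" "a \<in> P i" "2 \<le> dg M a" using assms(1) by (auto simp: ctr_def)
  obtain c where c: "c \<in> f" "c \<in> P k" "2 \<le> dg M c" using assms(2) by (auto simp: ctr_def)
  have "a = c" using unique_center[OF a(1,2) c(1) a(4) c(3)] .
  then show ?thesis using P_unique[OF assms(3,4) a(3)] c(2) by simp
qed

text \<open>These vertices serve as fillers of new edges: degree 1 leaves room for one more edge,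
  and being outside the core they use none of its capacity.\<close>

lemma leaf:
  assumes f: "f \<in> ctr i" and i: "i \<in> R" and k: "k \<in> R" "k \<noteq> i"
  shows "dg M (pt f k) = 1" "pt f k \<notin> core l"
proof -
  obtain h where h: "f \<in> M" "h \<in> f" "h \<in> P i" "2 \<le> dg M h" using f by (auto simp: ctr_def)
  have p: "pt f k \<in> f" "pt f k \<in> P k" using pt_in[OF M_Es[OF h(1)] k(1)] .
  have ne: "pt f k \<noteq> h" using P_unique[OF i k(1) h(3)] p(2) k(2) by auto
  then have "\<not> 2 \<le> dg M (pt f k)" using unique_center[OF h(1) p(1) h(2)] h(4) by auto
  then show "dg M (pt f k) = 1" using dg_pos[OF finite_M h(1) p(1)] by linarith
  show "pt f k \<notin> core l"
  proof
    assume "pt f k \<in> core l"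
    then have "\<forall>e\<in>M. pt f k \<in> e \<longrightarrow> (\<forall>c\<in>e. c \<noteq> pt f k \<longrightarrow> dg M c = 1)" by (simp add: core_def)
    then have "dg M h = 1" using h(1,2) p(1) ne by metis
    then show False using h(4) by simp
  qed
qed

text \<open>A vertex of degree at least 2 is the only centre on each of its edges, hence in the
  core.\<close>

lemma noncore:
  assumes "k \<in> R" "v \<in> P k" "v \<notin> core k"
  shows "dg M v \<le> 1"
proof (rule ccontr)
  assume "\<not> dg M v \<le> 1"
  then have v: "2 \<le> dg M v" by simp
  have "dg M c = 1" if "e \<in> M" "v \<in> e" "c \<in> e" "c \<noteq> v" for e c
  proof -
    have "\<not> 2 \<le> dg M c" using unique_center[OF that(1,2,3) v] that(4) by auto
    then show ?thesis using dg_pos[OF finite_M that(1,3)] by linarith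
  qed
  then have "v \<in> core k" using assms(2) v by (auto simp: core_def)
  then show False using assms(3) by simp
qed

text \<open>Let \<open>g0\<close> be a second edge of \<open>M\<close> at the centre of
  \<open>f\<close>. Of the \<open>d + 1\<close> neighbours at most one lies on \<open>g0\<close>;
  \<open>exchange_core\<close> puts all others into the core.\<close>

lemma core_nbrs:
  assumes J: "J \<subseteq> R" "i \<in> J" and j: "j \<in> R" "j \<notin> J" and f: "f \<in> ctr i"
    and xJ: "\<forall>k\<in>J. x k \<in> unc M \<inter> P k" and xf: "\<forall>k\<in>R - J - {j}. x k = pt f k"
  obtains N where "N \<subseteq> core j" "d \<le> card N" "\<forall>w\<in>N. insert w (x ` (R - {j})) \<in> Es"
proof -
  obtain h where h: "f \<in> M" "h \<in> f" "h \<in> P i" "2 \<le> dg M h" using f by (auto simp: ctr_def)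
  obtain g0 where g0: "g0 \<in> M" "g0 \<noteq> f" "h \<in> g0" using dg_ge_2E[OF finite_M h(4,1)] .
  have "\<forall>k\<in>R - {j}. x k \<in> P k"
  proof
    fix k assume k: "k \<in> R - {j}"
    show "x k \<in> P k"
    proof (cases "k \<in> J")
      case True
      then show ?thesis using xJ by simp
    next
      case False
      then have "x k = pt f k" using xf k by simp
      then show ?thesis using pt_in(2)[OF M_Es[OF h(1)]] k by simp
    qed
  qed
  then obtain N where N: "N \<subseteq> P j" "d + 1 \<le> card N" "\<forall>w\<in>N. insert w (x ` (R - {j})) \<in> Es"
    using codegree[of j x] j(1) by auto
  let ?N = "N - {pt g0 j}"
  show ?thesis
  proof (rule that[of ?N])
    show "?N \<subseteq> core j"
    proof
      fix w assume w: "w \<in> ?N"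
      have "w \<notin> g0" using pt_eq[OF M_Es[OF g0(1)] j(1), of w] w N(1) by auto
      then show "w \<in> core j"
        using exchange_core[OF J j h(1-3) g0 xJ xf, of w] w N by auto
    qed
    have "card N - 1 \<le> card ?N" using diff_card_le_card_Diff[of "{pt g0 j}" N] by simp
    then show "d \<le> card ?N" using N(2) by linarith
    show "\<forall>w\<in>?N. insert w (x ` (R - {j})) \<in> Es" using N(3) by simp
  qed
qed

text \<open>At a core vertex \<open>t - 1\<close> splits into the excess and the spare capacity; the
  excesses sum to at most \<open>exc j\<close>.\<close>

lemma core_sum:
  assumes j: "j \<in> R" and N: "N \<subseteq> core j"
  shows "(t - 1) * card N \<le> exc j + (\<Sum>w\<in>N. t - dg M w)"
proof -
  have "(t - 1) * card N = (\<Sum>w\<in>N. t - 1)" by simp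
  also have "\<dots> = (\<Sum>w\<in>N. (dg M w - 1) + (t - dg M w))"
  proof (rule sum.cong)
    fix w assume "w \<in> N"
    then have "1 \<le> dg M w" using N by (auto simp: core_def)
    then show "t - 1 = (dg M w - 1) + (t - dg M w)" using M_shallow[of w] by linarith
  qed simp
  also have "\<dots> = (\<Sum>w\<in>N. dg M w - 1) + (\<Sum>w\<in>N. t - dg M w)" by (rule sum.distrib)
  also have "(\<Sum>w\<in>N. dg M w - 1) \<le> exc j"
    unfolding exc_def by (rule sum_mono2) (use finite_P[OF j] N in \<open>auto simp: core_def\<close>)
  finally show ?thesis by simp
qed

section \<open>Bounding the number of uncovered vertices\<close>

text \<open>By \<open>core_sum\<close>, any \<open>d\<close> core vertices of part \<open>j\<close>
  have total spare capacity at least \<open>budget - card (unc M \<inter> P j)\<close>. As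
  \<open>d\<close> is one less than the codegree, this is the \<open>b\<close> of the
  overview.\<close>

definition budget :: int where "budget = int ((t - 1) * d) - (int (card M) - int n)"

text \<open>One uncovered vertex and a star edge of its part yield \<open>d\<close> core vertices in
  a fully covered part \<open>j\<close>, so the spare capacity \<open>df\<close> there is at least
  \<open>budget\<close>. The bound then comes from \<open>weight\<close>.\<close>

lemma card_unc_le_budget:
  assumes "unc M \<noteq> {}"
  shows "int (card (unc M)) \<le> int (r - 1) * budget"
proof -
  obtain j where j: "j \<in> R" "unc M \<inter> P j = {}" using some_part_covered by (elim bexE)
  obtain u where u: "u \<in> unc M" using assms by auto
  then have "u \<in> V" by (simp add: unc_def)
  then obtain i where i: "i \<in> R" "u \<in> P i" by (rule V_cases)
  have ui: "u \<in> unc M \<inter> P i" using u i by simp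
  then have "0 < card (unc M \<inter> P i)" by (intro card_gt_0_iff[THEN iffD2]) auto
  then have "0 < card (ctr i)" using card_ctr[OF i(1)] by linarith
  then obtain f where f: "f \<in> ctr i" by (metis card.empty ex_in_conv less_irrefl)
  have ji: "j \<notin> {i}" using ui j by auto
  define x where "x = (\<lambda>k. if k = i then u else pt f k)"
  obtain N where N: "N \<subseteq> core j" "d \<le> card N"
    by (rule core_nbrs[of "{i}" i j f x]) (use i ui j(1) ji f in \<open>auto simp: x_def\<close>)
  define df where "df = (\<Sum>w\<in>core j. t - dg M w)"
  have "(\<Sum>w\<in>N. t - dg M w) \<le> df"
    unfolding df_def by (rule sum_mono2) (use finite_core[OF j(1)] N in auto)
  moreover have "(t - 1) * d \<le> (t - 1) * card N" using N(2) by (rule mult_left_mono) simp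
  ultimately have "(t - 1) * d \<le> exc j + df" using core_sum[OF j(1) N(1)] by linarith
  define e where "e = int (card M) - int n"
  have "int (exc j) = e" using int_exc[OF j(1)] j(2) by (simp add: e_def)
  then have 1: "budget \<le> int df" using \<open>(t - 1) * d \<le> exc j + df\<close>
    unfolding budget_def e_def[symmetric] by linarith
  have "int (\<Sum>k\<in>R. exc k) = (\<Sum>k\<in>R. e + int (card (unc M \<inter> P k)))"
    unfolding of_nat_sum by (rule sum.cong) (use int_exc in \<open>simp_all add: e_def\<close>)
  also have "\<dots> = int r * e + int (card (unc M))"
    unfolding card_unc[of M] by (simp add: sum.distrib)
  finally have S: "int (\<Sum>k\<in>R. exc k) = int r * e + int (card (unc M))" .
  have "int (t * (\<Sum>k\<in>R. exc k) + df) \<le> int ((t - 1) * card M)"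
    using weight[OF j(1)] unfolding df_def by (simp only: of_nat_le_iff)
  then have 2: "int t * (int r * e + int (card (unc M))) + int df \<le> (int t - 1) * (e + int n)"
    using t2 S by (simp add: of_nat_diff e_def)
  have r1: "int (r - 1) = int r - 1" using r2 by (simp add: of_nat_diff)
  have "int n \<le> int (d * ((r - 1) * t + 1))" using n_le by (simp only: of_nat_le_iff)
  also have "\<dots> = int d * ((int r - 1) * int t + 1)"
    by (simp only: of_nat_mult of_nat_add of_nat_1 r1)
  finally have 3: "int n \<le> int d * ((int r - 1) * int t + 1)" .
  have b: "budget = (int t - 1) * int d - e" using t2 by (simp add: budget_def e_def of_nat_diff)
  have "(int t - 1) * int n \<le> (int t - 1) * (int d * ((int r - 1) * int t + 1))"
    using 3 t2 by (intro mult_left_mono) simp_all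
  \<comment> \<open>By 1 and 2, \<open>t * card (unc M)\<close> is at most
    \<open>(t - 1) * (e + n) - t * r * e - budget\<close>; inserting the bound 3 on \<open>n\<close>
    collapses this to \<open>t * (r - 1) * budget\<close>.\<close>
  then have "int t * int (card (unc M)) \<le> int t * ((int r - 1) * budget)"
    using 1 2 unfolding b by (simp add: algebra_simps)
  then have "int (card (unc M)) \<le> (int r - 1) * budget" using t2 by simp
  then show ?thesis using r2 by (simp add: of_nat_diff)
qed

section \<open>Greedy extension of the optimal family\<close>

text \<open>\<^term>\<open>A\<close> is a set of additional edges, of which at most \<^term>\<open>K j\<close> meet the core in part \<^term>\<open>j\<close>;
  an added edge uses as fillers only leaves of the edge \<^term>\<open>\<phi> i u\<close> reserved for a vertex
  \<^term>\<open>u\<close> that it covers for the first time.\<close>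

definition extension :: "(nat \<Rightarrow> 'a \<Rightarrow> 'a set) \<Rightarrow> 'a set set \<Rightarrow> (nat \<Rightarrow> nat) \<Rightarrow> bool" where
  "extension \<phi> A K \<longleftrightarrow> A \<subseteq> Es
    \<and> (\<forall>u\<in>unc M. dg A u \<le> 1)
    \<and> (\<forall>j\<in>R. \<forall>w\<in>core j. dg M w + dg A w \<le> t)
    \<and> (\<forall>j\<in>R. (\<Sum>w\<in>core j. dg A w) \<le> K j)
    \<and> (\<forall>v\<in>V. v \<notin> unc M \<longrightarrow> (\<forall>j\<in>R. v \<notin> core j) \<longrightarrow>
        dg A v = 0 \<or> dg A v = 1 \<and> (\<exists>i\<in>R. \<exists>u\<in>unc M \<inter> P i. dg A u \<noteq> 0 \<and> v \<in> \<phi> i u))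
    \<and> (\<forall>i\<in>R. card {u \<in> unc M \<inter> P i. dg A u = 0} \<le> card (unc M \<inter> P i) - (\<Sum>j\<in>R - {i}. K j))"

text \<open>The new edge takes a still uncovered vertex in each part of \<open>J\<close>, a core
  vertex with room in part \<open>j\<close>, and leaves of one reserved edge elsewhere.
  \<open>core_nbrs\<close> applies because vertices uncovered by \<open>A\<close> are chosen within
  \<open>unc M\<close>.\<close>

lemma extension_step:
  assumes \<phi>: "\<And>i. i \<in> R \<Longrightarrow> inj_on (\<phi> i) (unc M \<inter> P i)"
    "\<And>i u. i \<in> R \<Longrightarrow> u \<in> unc M \<inter> P i \<Longrightarrow> \<phi> i u \<in> ctr i"
    and ext: "extension \<phi> A K" and j: "j \<in> R"
    and cap: "int (K j) < budget - int (card (unc M \<inter> P j))"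
  shows "\<exists>A'. extension \<phi> A' (K(j := K j + 1))"
proof -
  let ?K = "K(j := K j + 1)"
  note E = ext[unfolded extension_def]
  have A_Es: "A \<subseteq> Es" using E by (elim conjE)
  have A_unc: "dg A u \<le> 1" if "u \<in> unc M" for u using E that by (elim conjE) simp
  have A_core: "dg M w + dg A w \<le> t" if "k \<in> R" "w \<in> core k" for k w
    using E that by (elim conjE) metis
  have A_sum: "(\<Sum>w\<in>core k. dg A w) \<le> K k" if "k \<in> R" for k using E that by (elim conjE) metis
  have A_leaf: "dg A v = 0 \<or> dg A v = 1 \<and> (\<exists>i\<in>R. \<exists>u\<in>unc M \<inter> P i. dg A u \<noteq> 0 \<and> v \<in> \<phi> i u)"
    if "v \<in> V" "v \<notin> unc M" "\<forall>j\<in>R. v \<notin> core j" for v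
    using E[THEN conjunct2, THEN conjunct2, THEN conjunct2, THEN conjunct2, THEN conjunct1] that
    by simp
  have A_card: "card {u \<in> unc M \<inter> P i. dg A u = 0} \<le> card (unc M \<inter> P i) - (\<Sum>j\<in>R - {i}. K j)"
    if "i \<in> R" for i using E that by (elim conjE) (rule bspec)
  have finA: "finite A" using A_Es finite_Es by (rule finite_subset)
  \<comment> \<open>Raising \<open>K j\<close> demands one more covered vertex in every part except
    \<open>j\<close>.\<close>
  have sumK: "(\<Sum>k\<in>R - {i}. ?K k) = (\<Sum>k\<in>R - {i}. K k) + (if i = j then 0 else 1)" for i
  proof (cases "i = j")
    case False
    then have "j \<in> R - {i}" using j by simp
    then have "(\<Sum>k\<in>R - {i}. ?K k) = ?K j + (\<Sum>k\<in>R - {i} - {j}. ?K k)"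
      by (intro sum.remove) simp_all
    also have "(\<Sum>k\<in>R - {i} - {j}. ?K k) = (\<Sum>k\<in>R - {i} - {j}. K k)" by (rule sum.cong) auto
    also have "?K j + \<dots> = 1 + (K j + (\<Sum>k\<in>R - {i} - {j}. K k))" by simp
    also have "K j + (\<Sum>k\<in>R - {i} - {j}. K k) = (\<Sum>k\<in>R - {i}. K k)"
      using \<open>j \<in> R - {i}\<close> by (intro sum.remove[symmetric]) simp_all
    finally show ?thesis using False by simp
  next
    case True
    have "(\<Sum>k\<in>R - {i}. ?K k) = (\<Sum>k\<in>R - {i}. K k)" by (rule sum.cong) (use True in auto)
    then show ?thesis using True by simp
  qed
  define J where "J = {i \<in> R - {j}. \<exists>u\<in>unc M \<inter> P i. dg A u = 0}"
  have empty: "{u \<in> unc M \<inter> P i. dg A u = 0} = {}" if "i \<in> R" "i \<noteq> j" "i \<notin> J" for i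
    using that by (auto simp: J_def)
  show ?thesis
  proof (cases "J = {}")
    case True
    \<comment> \<open>Outside part \<open>j\<close> everything is covered, so \<open>A\<close> stays
      and only the allowance grows.\<close>
    have "extension \<phi> A ?K"
      unfolding extension_def
    proof (intro conjI ballI impI)
      fix i assume i: "i \<in> R"
      show "card {u \<in> unc M \<inter> P i. dg A u = 0} \<le> card (unc M \<inter> P i) - (\<Sum>j\<in>R - {i}. ?K j)"
      proof (cases "i = j")
        case True
        then show ?thesis using A_card[OF i] sumK[of i] by simp
      next
        case False
        then have "{u \<in> unc M \<inter> P i. dg A u = 0} = {}" using empty[OF i] True by simp
        then show ?thesis by (simp only: card.empty le0)
      qed
    next
      fix k assume "k \<in> R"
      have "K k \<le> ?K k" by simp
      then show "(\<Sum>w\<in>core k. dg A w) \<le> ?K k" using A_sum[OF \<open>k \<in> R\<close>] by linarith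
    qed (use A_Es A_unc A_core A_leaf in \<open>simp_all\<close>)
    then show ?thesis by blast
  next
    case False
    then obtain i0 where i0: "i0 \<in> J" by blast
    have "\<forall>k\<in>J. \<exists>u. u \<in> unc M \<inter> P k \<and> dg A u = 0" by (auto simp: J_def)
    then obtain u where u: "\<forall>k\<in>J. u k \<in> unc M \<inter> P k \<and> dg A (u k) = 0" by (rule bchoice[THEN exE])
    have J: "J \<subseteq> R" "j \<notin> J" by (auto simp: J_def)
    have i0R: "i0 \<in> R" using i0 J by blast
    \<comment> \<open>One reserved edge, that of the new vertex in part \<open>i0\<close>, supplies
      all fillers.\<close>
    define f where "f = \<phi> i0 (u i0)"
    have f: "f \<in> ctr i0" unfolding f_def by (rule \<phi>(2)[OF i0R]) (use u i0 in simp)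
    have fM: "f \<in> M" using f by (simp add: ctr_def)
    define x where "x = (\<lambda>k. if k \<in> J then u k else pt f k)"
    obtain N where N: "N \<subseteq> core j" "d \<le> card N" "\<forall>w\<in>N. insert w (x ` (R - {j})) \<in> Es"
      by (rule core_nbrs[OF J(1) i0 j J(2) f, of x]) (use u in \<open>auto simp: x_def\<close>)
    have finN: "finite N" using N(1) finite_core[OF j] by (rule finite_subset)
    \<comment> \<open>Otherwise the added edges exhaust the spare capacity of \<open>N\<close>, and
      \<open>K j\<close> would already reach the bound in \<open>cap\<close>.\<close>
    have "\<exists>w\<in>N. dg M w + dg A w < t"
    proof (rule ccontr)
      assume neg: "\<not> (\<exists>w\<in>N. dg M w + dg A w < t)"
      have "(t - 1) * d \<le> (t - 1) * card N" using N(2) by (rule mult_left_mono) simp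
      also have "\<dots> \<le> exc j + (\<Sum>w\<in>N. t - dg M w)" by (rule core_sum[OF j N(1)])
      also have "(\<Sum>w\<in>N. t - dg M w) \<le> (\<Sum>w\<in>N. dg A w)"
        by (rule sum_mono) (use neg in \<open>auto simp: not_less\<close>)
      also have "\<dots> \<le> (\<Sum>w\<in>core j. dg A w)"
        by (rule sum_mono2) (use finite_core[OF j] N(1) in auto)
      also have "\<dots> \<le> K j" by (rule A_sum[OF j])
      finally have "(t - 1) * d \<le> exc j + K j" by simp
      then show False using cap int_exc[OF j] unfolding budget_def by linarith
    qed
    then obtain w where w: "w \<in> N" "dg M w + dg A w < t" by (elim bexE)
    have wcore: "w \<in> core j" using w N by blast
    define y where "y = insert w (x ` (R - {j}))"
    have yE: "y \<in> Es" using N(3) w(1) by (simp add: y_def)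
    have y_cases: "v = w \<or> (\<exists>k\<in>J. v = u k) \<or> (\<exists>k\<in>R. k \<noteq> i0 \<and> v = pt f k)" if "v \<in> y" for v
    proof -
      from that consider "v = w" | k where "k \<in> R - {j}" "v = x k" unfolding y_def by blast
      then show ?thesis
      proof cases
        case 2
        then show ?thesis using i0 by (cases "k \<in> J") (auto simp: x_def)
      qed simp
    qed
    have uy: "u k \<in> y" if "k \<in> J" for k
    proof -
      have "k \<in> R - {j}" using that J by auto
      then have "x k \<in> y" unfolding y_def by blast
      then show ?thesis using that by (simp add: x_def)
    qed
    have u0: "dg A (u k) = 0" "u k \<in> unc M" "u k \<in> P k" if "k \<in> J" for k using u that by auto
    have yA: "y \<notin> A" using dg_pos[OF finA _ uy[OF i0]] u0(1)[OF i0] by auto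
    let ?A = "insert y A"
    have dgA: "dg ?A v = dg A v + (if v \<in> y then 1 else 0)" for v by (rule dg_insert[OF finA yA])
    have unc0: "dg M v = 0" if "v \<in> unc M" for v using that by (simp add: unc_def)
    have core1: "1 \<le> dg M v" "v \<in> P k" if "v \<in> core k" for v k using that by (simp_all add: core_def)
    have leaf_f: "dg M (pt f k) = 1" "pt f k \<notin> core l" if "k \<in> R" "k \<noteq> i0" for k l
      using leaf[OF f i0R that] .
    have unc_y: "v = u k \<longrightarrow> dg A v = 0" if "k \<in> J" for v k using u0 that by simp
    have unc_in_y: "dg A v = 0" if v: "v \<in> unc M" "v \<in> y" for v
    proof -
      have "v \<noteq> w" using core1(1)[OF wcore] unc0[OF v(1)] by auto
      moreover have "v \<noteq> pt f k" if "k \<in> R" "k \<noteq> i0" for k using leaf_f(1)[OF that] unc0[OF v(1)] by auto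
      ultimately show ?thesis using y_cases[OF v(2)] u0 by metis
    qed
    have core_in_y: "v = w" if v: "v \<in> core k" "v \<in> y" for v k
    proof -
      have "v \<noteq> u l" if "l \<in> J" for l using unc0[OF u0(2)[OF that]] core1(1)[OF v(1)] by auto
      moreover have "v \<noteq> pt f l" if "l \<in> R" "l \<noteq> i0" for l using leaf_f(2)[OF that] v(1) by auto
      ultimately show ?thesis using y_cases[OF v(2)] by metis
    qed
    have "extension \<phi> ?A ?K"
      unfolding extension_def
    proof (intro conjI ballI impI)
      show "?A \<subseteq> Es" using A_Es yE by simp
    next
      fix v assume v: "v \<in> unc M"
      show "dg ?A v \<le> 1"
        using unc_in_y[OF v] A_unc[OF v] dgA[of v] by (cases "v \<in> y") simp_all
    next
      fix k v assume k: "k \<in> R" and v: "v \<in> core k"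
      show "dg M v + dg ?A v \<le> t"
      proof (cases "v \<in> y")
        case True
        then show ?thesis using core_in_y[OF v True] dgA[of v] w(2) by simp
      next
        case False
        then show ?thesis using A_core[OF k v] dgA[of v] by simp
      qed
    next
      fix k assume k: "k \<in> R"
      have "(\<Sum>v\<in>core k. dg ?A v) \<le> (\<Sum>v\<in>core k. dg A v + (if v = w then 1 else 0))"
      proof (rule sum_mono)
        fix v assume "v \<in> core k"
        then show "dg ?A v \<le> dg A v + (if v = w then 1 else 0)"
          using core_in_y[of v k] dgA[of v] by (cases "v \<in> y") simp_all
      qed
      also have "\<dots> = (\<Sum>v\<in>core k. dg A v) + (if w \<in> core k then 1 else 0)"
        using finite_core[OF k] by (simp add: sum.distrib)
      also have "\<dots> \<le> ?K k"
      proof (cases "k = j")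
        case True
        then show ?thesis using A_sum[OF k] by simp
      next
        case False
        then have "w \<notin> core k" using core1(2)[OF wcore] core1(2)[of w k] P_unique[OF k j, of w] by auto
        then show ?thesis using A_sum[OF k] False by simp
      qed
      finally show "(\<Sum>v\<in>core k. dg ?A v) \<le> ?K k" .
    next
      fix v assume v: "v \<in> V" "v \<notin> unc M" "\<forall>j\<in>R. v \<notin> core j"
      show "dg ?A v = 0 \<or> dg ?A v = 1 \<and> (\<exists>i\<in>R. \<exists>u\<in>unc M \<inter> P i. dg ?A u \<noteq> 0 \<and> v \<in> \<phi> i u)"
      proof (cases "v \<in> y")
        case False
        then show ?thesis using A_leaf[OF v] dgA[of v] dgA by auto
      next
        case True
        have "v \<noteq> w" using v(3) wcore j by auto
        moreover have "v \<noteq> u k" if "k \<in> J" for k using v(2) u0(2)[OF that] by auto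
        ultimately obtain k where k: "k \<in> R" "k \<noteq> i0" "v = pt f k" using y_cases[OF True] by metis
        have vf: "v \<in> f" using pt_in(1)[OF M_Es[OF fM] k(1)] k(3) by simp
        have "dg M v = 1" using leaf_f(1)[OF k(1,2)] k(3) by simp
        \<comment> \<open>A filler of degree 1 in \<open>M\<close> lies on \<open>f\<close> alone.
          Had it been used before, the reserved edge involved would be \<open>f\<close>, so its
          vertex would be \<open>u i0\<close>, which \<open>A\<close> does not cover yet.\<close>
        have "dg A v = 0"
        proof (rule ccontr)
          assume "dg A v \<noteq> 0"
          then obtain i a where a: "i \<in> R" "a \<in> unc M \<inter> P i" "dg A a \<noteq> 0" "v \<in> \<phi> i a"
            using A_leaf[OF v] by auto
          have ic: "\<phi> i a \<in> ctr i" using \<phi>(2)[OF a(1,2)] .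
          have "\<phi> i a = f"
          proof (rule ccontr)
            assume "\<phi> i a \<noteq> f"
            then have "0 < dg (M - {f}) v"
              using ic a(4) finite_M by (intro dg_pos[of _ "\<phi> i a"]) (auto simp: ctr_def)
            then show False using dg_remove[OF finite_M fM vf] \<open>dg M v = 1\<close> by simp
          qed
          then have ii: "i = i0" using ctr_unique[of f i i0] ic f a(1) i0R by simp
          have "\<phi> i0 a = \<phi> i0 (u i0)" using \<open>\<phi> i a = f\<close> ii by (simp add: f_def)
          then have "a = u i0"
            using inj_onD[OF \<phi>(1)[OF i0R]] a(2) ii u0(2,3)[OF i0] by auto
          then show False using a(3) u0(1)[OF i0] by simp
        qed
        then have "dg ?A v = 1" using dgA[of v] True by simp
        moreover have "dg ?A (u i0) \<noteq> 0" using dgA[of "u i0"] uy[OF i0] by simp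
        moreover have "u i0 \<in> unc M \<inter> P i0" using u0[OF i0] by simp
        moreover have "v \<in> \<phi> i0 (u i0)" using vf by (simp add: f_def)
        ultimately show ?thesis using i0R by (intro disjI2 conjI bexI)
      qed
    next
      fix i assume i: "i \<in> R"
      let ?S = "{a \<in> unc M \<inter> P i. dg A a = 0}" and ?S' = "{a \<in> unc M \<inter> P i. dg ?A a = 0}"
      have sub: "?S' \<subseteq> ?S" using dgA by auto
      have fin: "finite ?S" using finite_unc by simp
      show "card ?S' \<le> card (unc M \<inter> P i) - (\<Sum>j\<in>R - {i}. ?K j)"
      proof (cases "i = j")
        case True
        then show ?thesis using A_card[OF i] sumK[of i] card_mono[OF fin sub] by simp
      next
        case False
        show ?thesis
        proof (cases "i \<in> J")
          case True
          have "?S' \<subseteq> ?S - {u i}" using sub dgA[of "u i"] uy[OF True] by auto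
          then have "card ?S' \<le> card (?S - {u i})" using fin by (intro card_mono) auto
          also have "\<dots> = card ?S - 1" using u0[OF True] by (intro card_Diff_singleton) simp
          finally show ?thesis using A_card[OF i] sumK[of i] False by simp
        next
          case iJ: False
          have "?S' \<subseteq> {}" using sub unfolding empty[OF i False iJ] .
          then have "?S' = {}" by (rule subset_empty[THEN iffD1])
          then show ?thesis by (simp only: card.empty le0)
        qed
      qed
    qed
    then show ?thesis by blast
  qed
qed

text \<open>Induction on the total of \<open>K\<close>, lowering one positive \<open>K j\<close>.
  The strict inequality asked for by \<open>extension_step\<close> holds for the lowered
  value.\<close>

lemma ex_extension:
  assumes \<phi>: "\<And>i. i \<in> R \<Longrightarrow> inj_on (\<phi> i) (unc M \<inter> P i)"
    "\<And>i u. i \<in> R \<Longrightarrow> u \<in> unc M \<inter> P i \<Longrightarrow> \<phi> i u \<in> ctr i"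
    and cap: "\<And>j. j \<in> R \<Longrightarrow> K j = 0 \<or> int (K j) \<le> budget - int (card (unc M \<inter> P j))"
  shows "\<exists>A. extension \<phi> A K"
  using cap
proof (induction "\<Sum>j\<in>R. K j" arbitrary: K)
  case 0
  have K0: "K j = 0" if "j \<in> R" for j using 0(1) that by simp
  have "extension \<phi> {} K"
    unfolding extension_def
  proof (intro conjI ballI impI)
    fix i assume "i \<in> R"
    have "(\<Sum>j\<in>R - {i}. K j) = 0" using K0 by simp
    moreover have "card {u \<in> unc M \<inter> P i. dg {} u = 0} \<le> card (unc M \<inter> P i)"
      by (rule card_mono) auto
    ultimately show "card {u \<in> unc M \<inter> P i. dg {} u = 0}
        \<le> card (unc M \<inter> P i) - (\<Sum>j\<in>R - {i}. K j)" by linarith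
  qed (use M_shallow in \<open>simp_all add: dg_def\<close>)
  then show ?case by blast
next
  case (Suc m)
  have "(\<Sum>j\<in>R. K j) \<noteq> 0" using Suc.hyps(2) by linarith
  then obtain j where j: "j \<in> R" "K j \<noteq> 0" by (metis sum.neutral)
  let ?K = "K(j := K j - 1)"
  have "(\<Sum>k\<in>R. K k) = K j + (\<Sum>k\<in>R - {j}. K k)" using j by (intro sum.remove) simp_all
  moreover have "(\<Sum>k\<in>R. ?K k) = ?K j + (\<Sum>k\<in>R - {j}. ?K k)" using j by (intro sum.remove) simp_all
  moreover have "(\<Sum>k\<in>R - {j}. ?K k) = (\<Sum>k\<in>R - {j}. K k)" by (rule sum.cong) auto
  moreover have "?K j = K j - 1" by simp
  ultimately have sum: "m = (\<Sum>k\<in>R. ?K k)" using Suc.hyps(2) j(2) by linarith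
  have Kj: "int (K j) \<le> budget - int (card (unc M \<inter> P j))" using Suc.prems[OF j(1)] j(2) by simp
  have "\<exists>A. extension \<phi> A ?K"
  proof (rule Suc.hyps(1)[OF sum])
    fix k assume "k \<in> R"
    then show "?K k = 0 \<or> int (?K k) \<le> budget - int (card (unc M \<inter> P k))"
      using Suc.prems[of k] Kj by (cases "k = j") auto
  qed
  then obtain A where A: "extension \<phi> A ?K" by (elim exE)
  have "\<exists>A'. extension \<phi> A' (?K(j := ?K j + 1))"
    by (rule extension_step[OF \<phi> A j(1)]) (use Kj j(2) in \<open>simp_all\<close>)
  moreover have "?K(j := ?K j + 1) = K" using j(2) by (intro ext) simp
  ultimately show ?case by simp
qed

lemma ex_hitting:
  "\<exists>B\<subseteq>Es. \<forall>v\<in>V. 1 \<le> dg B v \<and> dg B v \<le> t"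
proof (cases "unc M = {}")
  case True
  have "\<forall>v\<in>V. 1 \<le> dg M v \<and> dg M v \<le> t"
  proof
    fix v assume "v \<in> V"
    then have "dg M v \<noteq> 0" using True by (auto simp: unc_def)
    then show "1 \<le> dg M v \<and> dg M v \<le> t" using M_shallow[of v] by simp
  qed
  then show ?thesis using M_sub by blast
next
  case False
  have "\<forall>i\<in>R. \<exists>g. g ` (unc M \<inter> P i) \<subseteq> ctr i \<and> inj_on g (unc M \<inter> P i)"
    using card_ctr finite_M by (intro ballI card_le_inj) (auto simp: ctr_def)
  then obtain \<phi> where \<phi>: "\<forall>i\<in>R. \<phi> i ` (unc M \<inter> P i) \<subseteq> ctr i \<and> inj_on (\<phi> i) (unc M \<inter> P i)"
    by (rule bchoice[THEN exE])
  \<comment> \<open>\<open>nat\<close> replaces a negative allowance by \<open>0\<close>; the lower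
    bound \<open>budget - card (unc M \<inter> P j)\<close> persists.\<close>
  define K where "K j = nat (budget - int (card (unc M \<inter> P j)))" for j
  have "\<exists>A. extension \<phi> A K"
  proof (rule ex_extension)
    show "\<And>i. i \<in> R \<Longrightarrow> inj_on (\<phi> i) (unc M \<inter> P i)" using \<phi> by simp
    show "\<And>i u. i \<in> R \<Longrightarrow> u \<in> unc M \<inter> P i \<Longrightarrow> \<phi> i u \<in> ctr i" using \<phi> by (simp add: image_subset_iff)
    show "\<And>j. j \<in> R \<Longrightarrow> K j = 0 \<or> int (K j) \<le> budget - int (card (unc M \<inter> P j))"
      by (simp add: K_def)
  qed
  then obtain A where A: "extension \<phi> A K" by (elim exE)
  note E = A[unfolded extension_def]
  have A_Es: "A \<subseteq> Es" using E by (elim conjE)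
  have finA: "finite A" using A_Es finite_Es by (rule finite_subset)
  have covered: "dg A u \<noteq> 0" if i: "i \<in> R" and u: "u \<in> unc M" "u \<in> P i" for i u
  proof -
    \<comment> \<open>Summing \<open>budget\<close> minus the uncovered count over the parts other
      than \<open>i\<close> gives \<open>(r - 1) * budget\<close> minus the uncovered vertices
      outside part \<open>i\<close>, hence at least those in part \<open>i\<close>.\<close>
    have "int (card (unc M \<inter> P i)) + (\<Sum>j\<in>R - {i}. int (card (unc M \<inter> P j))) = int (card (unc M))"
      unfolding card_unc[of M] of_nat_sum using i by (intro sum.remove[symmetric]) simp_all
    moreover have "int (card (unc M)) \<le> int (r - 1) * budget" using card_unc_le_budget[OF False] .
    moreover have "int (r - 1) * budget = (\<Sum>j\<in>R - {i}. budget)" using i by simp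
    ultimately have "int (card (unc M \<inter> P i)) \<le> (\<Sum>j\<in>R - {i}. budget - int (card (unc M \<inter> P j)))"
      by (simp only: sum_subtractf)
    also have "\<dots> \<le> (\<Sum>j\<in>R - {i}. int (K j))" by (rule sum_mono) (simp add: K_def)
    finally have "card (unc M \<inter> P i) \<le> (\<Sum>j\<in>R - {i}. K j)"
      by (simp only: of_nat_sum[symmetric] of_nat_le_iff)
    moreover have "card {u \<in> unc M \<inter> P i. dg A u = 0} \<le> card (unc M \<inter> P i) - (\<Sum>j\<in>R - {i}. K j)"
      using E i by (elim conjE) (rule bspec)
    ultimately have "card {u \<in> unc M \<inter> P i. dg A u = 0} = 0" by linarith
    then have "{u \<in> unc M \<inter> P i. dg A u = 0} = {}" using finite_unc by (simp only: card_0_eq finite_Collect_conjI finite_Int simp_thms Collect_mem_eq)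
    then show ?thesis using u by auto
  qed
  have "1 \<le> dg (M \<union> A) v \<and> dg (M \<union> A) v \<le> t" if v: "v \<in> V" for v
  proof -
    obtain k where k: "k \<in> R" "v \<in> P k" using v by (rule V_cases)
    have le: "dg (M \<union> A) v \<le> dg M v + dg A v" by (rule dg_Un_le[OF finite_M finA])
    have ge: "dg M v \<le> dg (M \<union> A) v" "dg A v \<le> dg (M \<union> A) v"
      using finite_M finA by (intro dg_mono; simp)+
    \<comment> \<open>Vertices of \<open>unc M\<close> are covered by \<open>A\<close> exactly once;
      core vertices respect their capacity; leaves have degree 1 in \<open>M\<close> and at most 1
      in \<open>A\<close>, within \<open>t\<close> as \<open>2 \<le> t\<close>.\<close>
    consider "v \<in> unc M" | "v \<notin> unc M" "v \<in> core k" | "v \<notin> unc M" "v \<notin> core k" by blast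
    then show ?thesis
    proof cases
      case 1
      then have "dg A v \<le> 1" using E by (elim conjE) simp
      then show ?thesis using covered[OF k(1) 1 k(2)] le ge 1 t2 by (simp add: unc_def)
    next
      case 2
      then have "dg M v + dg A v \<le> t" using E k(1) by (elim conjE) metis
      moreover have "1 \<le> dg M v" using 2 by (simp add: core_def)
      ultimately show ?thesis using le ge by linarith
    next
      case 3
      have "v \<notin> core j" if "j \<in> R" for j
      proof
        assume vj: "v \<in> core j"
        then have "j = k" using P_unique[OF that k(1), of v] k(2) by (simp add: core_def)
        then show False using 3 vj by simp
      qed
      then have "dg A v = 0 \<or> dg A v = 1"
        using E[THEN conjunct2, THEN conjunct2, THEN conjunct2, THEN conjunct2, THEN conjunct1] v 3 by auto
      moreover have "dg M v \<le> 1" using noncore[OF k 3(2)] .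
      moreover have "1 \<le> dg M v" using 3(1) v by (simp add: unc_def)
      ultimately show ?thesis using le ge t2 by linarith
    qed
  qed
  then show ?thesis using M_sub A_Es by (intro exI[of _ "M \<union> A"]) simp
qed

end

section \<open>From edge sets to hypergraphs with multiset edges\<close>

lemma (in codegree_partite) ex_hitting_shallow:
  "\<exists>B\<subseteq>Es. \<forall>v\<in>V. 1 \<le> dg B v \<and> dg B v \<le> t"
proof -
  obtain M where M: "M \<subseteq> Es" "\<And>v. dg M v \<le> t"
    "\<And>M'. M' \<subseteq> Es \<Longrightarrow> (\<And>v. dg M' v \<le> t) \<Longrightarrow> cost M \<le> cost M'"
    by (rule ex_optimal) blast
  interpret optimal_family r t n d P Es M by unfold_locales (use M in auto)
  show ?thesis by (rule ex_hitting)
qed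

theorem theorem4p12:
  fixes r t n :: nat and P :: "nat \<Rightarrow> 'a set" and H :: "'a hypergraph"
  assumes "r \<ge> 2" and "t \<ge> 2"
    and "hypergraph H" and "uniform r H" and "partite r P H"
    and "\<forall>i\<in>{1..r}. card (P i) = n"
    and "int (min_codegree r P H) \<ge> \<lceil>real n / ((real r - 1) * real t + 1)\<rceil> + 1"
  shows "\<exists>M. M \<subseteq># edges H \<and> hitting H M \<and> shallow t H M"
proof -
  define Es where "Es = set_mset (edges H)"
  define d where "d = min_codegree r P H - 1"
  have V: "(\<Union>i\<in>{1..r}. P i) = verts H" and disj: "disjoint_family_on P {1..r}"
    and meet: "\<And>e i. e \<in> Es \<Longrightarrow> i \<in> {1..r} \<Longrightarrow> card (e \<inter> P i) \<le> 1"
    using assms(5) by (simp_all add: partite_def Es_def)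
  have finV: "finite (verts H)" and EV: "\<And>e. e \<in> Es \<Longrightarrow> e \<subseteq> verts H"
    using assms(3) by (simp_all add: hypergraph_def Es_def)
  have cardE: "\<And>e. e \<in> Es \<Longrightarrow> card e = r" using assms(4) by (simp add: uniform_def Es_def)
  have PV: "P i \<subseteq> verts H" if "i \<in> {1..r}" for i using V that by blast
  have finP: "finite (P i)" if "i \<in> {1..r}" for i using PV[OF that] finV by (rule finite_subset)
  have disjP: "P i \<inter> P k = {}" if "i \<in> {1..r}" "k \<in> {1..r}" "i \<noteq> k" for i k
    using disjoint_family_onD[OF disj that] .
  have mono: "i = k" if "i \<in> {1..r}" "k \<in> {1..r}" "v \<in> P i" "v \<in> P k" for i k v
    using disjP[OF that(1,2)] that(3,4) by auto
  define D where "D = (r - 1) * t + 1"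
  have D: "real D = (real r - 1) * real t + 1" using assms(1) by (simp add: D_def of_nat_diff)
  have Dpos: "0 < real D" unfolding of_nat_0_less_iff by (simp only: D_def zero_less_Suc Suc_eq_plus1[symmetric])
  have ceil: "\<lceil>real n / real D\<rceil> + 1 \<le> int (min_codegree r P H)" using assms(7) unfolding D .
  \<comment> \<open>Hence the minimum codegree is positive and the truncated subtraction in
    \<open>d\<close> is exact.\<close>
  have "0 \<le> \<lceil>real n / real D\<rceil>" using Dpos by (simp add: zero_le_ceiling less_le_trans[of "-1" 0])
  then have d1: "min_codegree r P H = d + 1" and "\<lceil>real n / real D\<rceil> \<le> int d"
    using ceil unfolding d_def by linarith+
  then have "real n / real D \<le> real d" by (simp add: ceiling_le_iff)
  then have "real n \<le> real d * real D" using Dpos by (simp add: pos_divide_le_eq)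
  then have nd: "n \<le> d * D" by (simp only: of_nat_mult[symmetric] of_nat_le_iff)
  have edge_part: "\<exists>v. e \<inter> P i = {v}" if e: "e \<in> Es" and i: "i \<in> {1..r}" for e i
  proof -
    \<comment> \<open>An edge missing a part would have at most \<open>r - 1\<close>
      vertices.\<close>
    have "card (e \<inter> P i) \<noteq> 0"
    proof
      assume 0: "card (e \<inter> P i) = 0"
      have "e = (\<Union>k\<in>{1..r}. e \<inter> P k)" using EV[OF e] V by auto
      then have "card e = card (\<Union>k\<in>{1..r}. e \<inter> P k)" by (rule arg_cong)
      also have "\<dots> \<le> (\<Sum>k\<in>{1..r}. card (e \<inter> P k))" by (rule card_UN_le) simp
      also have "\<dots> = (\<Sum>k\<in>{1..r} - {i}. card (e \<inter> P k))"
        using i 0 by (subst sum.remove[of _ i]) simp_all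
      also have "\<dots> \<le> (\<Sum>k\<in>{1..r} - {i}. 1)" by (rule sum_mono) (use meet[OF e] in simp)
      also have "\<dots> = r - 1" using i by simp
      finally show False using cardE[OF e] assms(1) by simp
    qed
    then have "card (e \<inter> P i) = 1" using meet[OF e i] by linarith
    then show ?thesis by (rule card_1_singletonE) blast
  qed
  have codegree: "\<exists>N\<subseteq>P j. d + 1 \<le> card N \<and> (\<forall>w\<in>N. insert w (x ` ({1..r} - {j})) \<in> Es)"
    if x: "\<forall>i\<in>{1..r} - {j}. x i \<in> P i" and j: "j \<in> {1..r}" for x :: "nat \<Rightarrow> 'a" and j
  proof -
    let ?S = "x ` ({1..r} - {j})"
    have "inj_on x ({1..r} - {j})"
      by (rule inj_onI) (metis x mono DiffD1)
    then have cS: "card ?S = r - 1" using j by (simp add: card_image)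
    have "?S \<subseteq> verts H" using x PV by blast
    moreover have "card (?S \<inter> P i) \<le> 1" if i: "i \<in> {1..r}" for i
    proof -
      have "?S \<inter> P i \<subseteq> {x i}"
      proof
        fix v assume v: "v \<in> ?S \<inter> P i"
        then obtain k where k: "k \<in> {1..r} - {j}" "v = x k" by (elim IntE imageE)
        then have "k = i" using mono[of k i v] i v x by simp
        then show "v \<in> {x i}" using k by simp
      qed
      then have "card (?S \<inter> P i) \<le> card {x i}" by (rule card_mono[rotated]) simp
      then show ?thesis by simp
    qed
    ultimately have legal: "legal r P H ?S" by (simp add: legal_def)
    let ?C = "{card (nbhd H S) | S. legal r P H S \<and> card S = r - 1}"
    \<comment> \<open>\<open>Min\<close> is taken over a finite set that has a member, given by
      \<open>?S\<close>. With empty parts no such \<open>x\<close> exists, as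
      \<open>2 \<le> r\<close>.\<close>
    have "?C \<subseteq> {..card (verts H)}"
      using finV by (auto simp: nbhd_def intro!: card_mono)
    then have "finite ?C" by (rule finite_subset) simp
    moreover have "card (nbhd H ?S) \<in> ?C" using legal cS by blast
    ultimately have "min_codegree r P H \<le> card (nbhd H ?S)"
      unfolding min_codegree_def by (rule Min_le)
    moreover have "nbhd H ?S \<subseteq> P j"
    proof
      fix v assume v: "v \<in> nbhd H ?S"
      then have e: "insert v ?S \<in> Es" by (simp add: nbhd_def Es_def)
      have "v \<in> (\<Union>i\<in>{1..r}. P i)" using v unfolding V by (simp add: nbhd_def)
      then obtain k where k: "k \<in> {1..r}" "v \<in> P k" by (elim UN_E)
      \<comment> \<open>A neighbour in another part \<open>k\<close> would coincide with
        \<open>x k\<close>, since an edge meets \<open>P k\<close> once; then \<open>?S\<close>, of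
        size \<open>r - 1\<close>, would itself be an edge.\<close>
      have "k = j"
      proof (rule ccontr)
        assume "k \<noteq> j"
        then have kS: "x k \<in> ?S" "x k \<in> P k" using k(1) x by auto
        obtain a where "insert v ?S \<inter> P k = {a}" using edge_part[OF e k(1)] by (elim exE)
        moreover have "v \<in> insert v ?S \<inter> P k" using k(2) by (intro IntI insertI1)
        moreover have "x k \<in> insert v ?S \<inter> P k" by (intro IntI insertI2 kS)
        ultimately have "v = x k" by (metis singletonD)
        then have "insert v ?S = ?S" using kS(1) by (simp only: insert_absorb)
        then show False using cardE[OF e] cS assms(1) by simp
      qed
      then show "v \<in> P j" using k(2) by simp
    qed
    moreover have "\<forall>w\<in>nbhd H ?S. insert w ?S \<in> Es" by (simp add: nbhd_def Es_def)
    ultimately show ?thesis using d1 by (intro exI[of _ "nbhd H ?S"]) simp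
  qed
  interpret codegree_partite r t n d P Es
  proof
    show "\<And>e. e \<in> Es \<Longrightarrow> e \<subseteq> (\<Union>i\<in>{1..r}. P i)" using EV V by simp
    show "n \<le> d * ((r - 1) * t + 1)" using nd by (simp only: D_def)
    show "\<And>i. i \<in> {1..r} \<Longrightarrow> card (P i) = n" using assms(6) by (rule bspec)
  qed (fact assms(1) assms(2) finP disjP edge_part codegree)+
  obtain B where B: "B \<subseteq> Es" "\<forall>v\<in>verts H. 1 \<le> dg B v \<and> dg B v \<le> t"
    using ex_hitting_shallow unfolding V_def V by (elim exE conjE)
  have finB: "finite B" using B(1) finite_Es by (rule finite_subset)
  \<comment> \<open>\<open>mset_set\<close> takes each edge once, so counting with multiplicity
    agrees with \<open>dg\<close>.\<close>
  have deg: "deg (mset_set B) v = dg B v" for v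
    using finB by (simp add: deg_def dg_def filter_mset_mset_set)
  have "mset_set B \<subseteq># mset_set Es" using B(1) finite_Es by (rule subset_imp_msubset_mset_set)
  also have "\<dots> \<subseteq># edges H" unfolding Es_def by (rule mset_set_set_mset_msubset)
  finally have "mset_set B \<subseteq># edges H" .
  moreover have "hitting H (mset_set B)" "shallow t H (mset_set B)"
    using B(2) by (simp_all add: hitting_def shallow_def deg)
  ultimately show ?thesis by blast
qed

end
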